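(* Let $W$ be an irreducible $T$-module. Then the triple $A, A^*, A^{\varepsilon}$ acts on $W$ as a Leonard triple; that is, the restrictions of $A$, $A^*$, $A^{\varepsilon}$ to $W$ form a Leonard triple on $W$.
   Context: Let $D$ be a positive integer and let $Q_D$ be the $D$-cube: the graph with vertex set $X=\{0,1\}^D$, two vertices being adjacent iff they differ in exactly one coordinate; $\partial$ denotes path-length distance. $\mathrm{Mat}_X(\mathbb{C})$ is the algebra of complex matrices with rows and columns indexed by $X$, acting on $V=\mathbb{C}^X$ (column vectors) by left multiplication. Write $\mathbf{i}^2=-1$. Let $A$ be the adjacency matrix of $Q_D$. Fix $x=(0,0,\ldots,0)\in X$. Let $A^*$ be the diagonal matrix in $\mathrm{Mat}_X(\mathbb{C})$ with $(y,y)$-entry $D-2\partial(x,y)$ for $y\in X$ (the dual adjacency matrix). Let $A^{\varepsilon}=-\mathbf{i}(AA^*-A^*A)/2$ (the imaginary adjacency matrix). Let $T$ be the subalgebra of $\mathrm{Mat}_X(\mathbb{C})$ generated by $A$ and $A^*$ (the Terwilliger algebra). A $T$-module is a subspace $W\subseteq V$ with $BW\subseteq W$ for all $B\in T$; it is irreducible if $W\neq 0$ and $W$ contains no $T$-modules other than $0$ and $W$. A square complex matrix is tridiagonal if each nonzero entry lies on the diagonal, the subdiagonal or the superdiagonal; a tridiagonal matrix is irreducible if every entry on the subdiagonal and every entry on the superdiagonal is nonzero. For a complex vector space $U$ of finite positive dimension, a Leonard triple on $U$ is an ordered triple of linear operators $(L_1,L_2,L_3)$ on $U$ such that for each $k\in\{1,2,3\}$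 there is a basis of $U$ with respect to which the matrix representing $L_k$ is diagonal and the matrices representing the other two operators are irreducible tridiagonal. *)

theory Defs
  imports "HOL-Analysis.Analysis"
begin

section \<open>Leonard triples\<close>

text \<open>
  Subspaces, bases and dimension in \<open>complex ^ 'n\<close> are taken over the complex numbers
  (the constants \<open>vec.\<dots>\<close>), not over the reals. Bases are ordered: the basis vectors are
  \<open>b 0, \<dots>, b (n - 1)\<close>, and an \<open>n\<close> by \<open>n\<close> matrix is a function of two indices
  below \<open>n\<close>, whose values elsewhere are irrelevant.
\<close>

definition is_basis_of :: "(complex ^ 'n) set \<Rightarrow> nat \<Rightarrow> (nat \<Rightarrow> complex ^ 'n) \<Rightarrow> bool" where
  "is_basis_of U n b \<longleftrightarrow>
     inj_on b {..<n} \<and> vec.independent (b ` {..<n}) \<and> vec.span (b ` {..<n}) = U"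

definition represents ::
    "nat \<Rightarrow> (nat \<Rightarrow> complex ^ 'n) \<Rightarrow> (complex ^ 'n \<Rightarrow> complex ^ 'n) \<Rightarrow> (nat \<Rightarrow> nat \<Rightarrow> complex) \<Rightarrow> bool" where
  "represents n b L M \<longleftrightarrow> (\<forall>j<n. L (b j) = (\<Sum>i<n. M i j *s b i))"

definition diagonal_mat :: "nat \<Rightarrow> (nat \<Rightarrow> nat \<Rightarrow> complex) \<Rightarrow> bool" where
  "diagonal_mat n M \<longleftrightarrow> (\<forall>i<n. \<forall>j<n. M i j \<noteq> 0 \<longrightarrow> i = j)"

definition tridiagonal_mat :: "nat \<Rightarrow> (nat \<Rightarrow> nat \<Rightarrow> complex) \<Rightarrow> bool" where
  "tridiagonal_mat n M \<longleftrightarrow> (\<forall>i<n. \<forall>j<n. M i j \<noteq> 0 \<longrightarrow> i = j \<or> i = Suc j \<or> j = Suc i)"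

definition irreducible_tridiagonal_mat :: "nat \<Rightarrow> (nat \<Rightarrow> nat \<Rightarrow> complex) \<Rightarrow> bool" where
  "irreducible_tridiagonal_mat n M \<longleftrightarrow>
     tridiagonal_mat n M \<and> (\<forall>i. Suc i < n \<longrightarrow> M (Suc i) i \<noteq> 0 \<and> M i (Suc i) \<noteq> 0)"

definition linear_operator_on :: "(complex ^ 'n) set \<Rightarrow> (complex ^ 'n \<Rightarrow> complex ^ 'n) \<Rightarrow> bool" where
  "linear_operator_on U L \<longleftrightarrow>
     (\<forall>u\<in>U. L u \<in> U) \<and>
     (\<forall>u\<in>U. \<forall>v\<in>U. L (u + v) = L u + L v) \<and>
     (\<forall>c. \<forall>u\<in>U. L (c *s u) = c *s L u)"

definition leonard_condition ::
    "(complex ^ 'n) set \<Rightarrow> (complex ^ 'n \<Rightarrow> complex ^ 'n) \<Rightarrow>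
     (complex ^ 'n \<Rightarrow> complex ^ 'n) \<Rightarrow> (complex ^ 'n \<Rightarrow> complex ^ 'n) \<Rightarrow> bool" where
  "leonard_condition U L L' L'' \<longleftrightarrow>
     (\<exists>b M M' M''. is_basis_of U (vec.dim U) b \<and>
        represents (vec.dim U) b L M \<and> diagonal_mat (vec.dim U) M \<and>
        represents (vec.dim U) b L' M' \<and> irreducible_tridiagonal_mat (vec.dim U) M' \<and>
        represents (vec.dim U) b L'' M'' \<and> irreducible_tridiagonal_mat (vec.dim U) M'')"

text \<open>
  The operators are given as functions on the ambient space, but only their restrictions to
  \<open>U\<close> matter: every condition below evaluates them at elements of \<open>U\<close> only.
\<close>

definition leonard_triple_on ::
    "(complex ^ 'n) set \<Rightarrow> (complex ^ 'n \<Rightarrow> complex ^ 'n) \<Rightarrow>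
     (complex ^ 'n \<Rightarrow> complex ^ 'n) \<Rightarrow> (complex ^ 'n \<Rightarrow> complex ^ 'n) \<Rightarrow> bool" where
  "leonard_triple_on U L1 L2 L3 \<longleftrightarrow>
     vec.subspace U \<and> vec.dim U > 0 \<and>
     linear_operator_on U L1 \<and> linear_operator_on U L2 \<and> linear_operator_on U L3 \<and>
     leonard_condition U L1 L2 L3 \<and>
     leonard_condition U L2 L1 L3 \<and>
     leonard_condition U L3 L1 L2"

section \<open>Matrix algebras and their modules\<close>

definition smult_matrix :: "complex \<Rightarrow> complex ^ 'n ^ 'm \<Rightarrow> complex ^ 'n ^ 'm" where
  "smult_matrix c M = (\<chi> i j. c * M $ i $ j)"

definition matrix_subalgebra :: "(complex ^ 'n ^ 'n) set \<Rightarrow> bool" where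
  "matrix_subalgebra S \<longleftrightarrow>
     mat 1 \<in> S \<and>
     (\<forall>B\<in>S. \<forall>C\<in>S. B + C \<in> S) \<and>
     (\<forall>c. \<forall>B\<in>S. smult_matrix c B \<in> S) \<and>
     (\<forall>B\<in>S. \<forall>C\<in>S. B ** C \<in> S)"

definition generated_subalgebra :: "(complex ^ 'n ^ 'n) set \<Rightarrow> (complex ^ 'n ^ 'n) set" where
  "generated_subalgebra G = \<Inter>{S. matrix_subalgebra S \<and> G \<subseteq> S}"

definition is_module :: "(complex ^ 'n ^ 'n) set \<Rightarrow> (complex ^ 'n) set \<Rightarrow> bool" where
  "is_module T W \<longleftrightarrow> vec.subspace W \<and> (\<forall>B\<in>T. \<forall>w\<in>W. B *v w \<in> W)"

definition irreducible_module :: "(complex ^ 'n ^ 'n) set \<Rightarrow> (complex ^ 'n) set \<Rightarrow> bool" where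
  "irreducible_module T W \<longleftrightarrow>
     is_module T W \<and> W \<noteq> {0} \<and>
     (\<forall>U. is_module T U \<and> U \<subseteq> W \<longrightarrow> U = {0} \<or> U = W)"

section \<open>The hypercube\<close>

text \<open>
  The coordinates of the \<open>D\<close>-cube are indexed by a finite type \<open>'d\<close>, so \<open>D = CARD('d) > 0\<close>;
  the entries 0 and 1 of a vertex are \<open>False\<close> and \<open>True\<close>.
\<close>

type_synonym 'd vertex = "bool ^ 'd"

definition cube_edges :: "('d::finite vertex \<times> 'd vertex) set" where
  "cube_edges = {(y, z). \<exists>!i. y $ i \<noteq> z $ i}"

text \<open>A pair lies in \<open>cube_edges ^^ n\<close> iff its vertices are joined by a walk of length \<open>n\<close>.\<close>

definition cube_dist :: "'d::finite vertex \<Rightarrow> 'd vertex \<Rightarrow> nat" where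
  "cube_dist y z = (LEAST n. (y, z) \<in> cube_edges ^^ n)"

definition base_vertex :: "'d::finite vertex" where
  "base_vertex = (\<chi> i. False)"

definition adjacency_matrix :: "complex ^ ('d::finite vertex) ^ ('d vertex)" where
  "adjacency_matrix = (\<chi> y z. if (y, z) \<in> cube_edges then 1 else 0)"

definition dual_adjacency_matrix :: "complex ^ ('d::finite vertex) ^ ('d vertex)" where
  "dual_adjacency_matrix =
     (\<chi> y z. if y = z then of_nat CARD('d) - 2 * of_nat (cube_dist base_vertex y) else 0)"

definition imaginary_adjacency_matrix :: "complex ^ ('d::finite vertex) ^ ('d vertex)" where
  "imaginary_adjacency_matrix =
     smult_matrix (- \<i> / 2)
       (adjacency_matrix ** dual_adjacency_matrix - dual_adjacency_matrix ** adjacency_matrix)"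

definition terwilliger_algebra :: "(complex ^ ('d::finite vertex) ^ ('d vertex)) set" where
  "terwilliger_algebra = generated_subalgebra {adjacency_matrix, dual_adjacency_matrix}"

end

theory Submission
  imports Defs "HOL-Computational_Algebra.Fundamental_Theorem_Algebra"
begin

text \<open>
  The three matrices satisfy the cyclic relations \<open>[X, Y] = 2\<i>Z\<close>, \<open>[Y, Z] = 2\<i>X\<close>,
  \<open>[Z, X] = 2\<i>Y\<close>, so \<open>W\<close> is an irreducible module of \<open>sl\<^sub>2\<close>. The combinations
  \<open>Y + \<i>Z\<close> and \<open>Y - \<i>Z\<close> raise and lower eigenvalues of \<open>X\<close> by 2. Lowering a highest weight
  vector repeatedly gives a basis of \<open>W\<close> in which \<open>X\<close> is diagonal and \<open>Y\<close>, \<open>Z\<close> are irreducible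
  tridiagonal; the other two bases come from the cyclic symmetry of the relations.
\<close>

section \<open>Eigenvectors\<close>

lemma independent_if_notin_span_earlier:
  fixes b :: "nat \<Rightarrow> complex ^ 'n"
  assumes "\<And>k. k < n \<Longrightarrow> b k \<notin> vec.span (b ` {..<k})"
  shows "inj_on b {..<n} \<and> vec.independent (b ` {..<n})"
  using assms
proof (induction n)
  case 0
  show ?case by (simp only: lessThan_0 image_empty inj_on_empty vec.independent_empty simp_thms)
next
  case (Suc n)
  then have IH: "inj_on b {..<n}" "vec.independent (b ` {..<n})"
    and new: "b n \<notin> vec.span (b ` {..<n})"
    by auto
  from new have "b n \<notin> b ` {..<n}"
    using vec.span_base by (rule contrapos_nn)
  with IH new show ?case
    by (auto simp: lessThan_Suc vec.independent_insertI)
qed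

text \<open>Otherwise the first \<open>CARD('n) + 1\<close> terms would be independent. This is what
  stops every infinite sequence built below: powers of a matrix, raising strings and lowering
  strings.\<close>

lemma ex_in_span_earlier:
  fixes b :: "nat \<Rightarrow> complex ^ 'n"
  shows "\<exists>k. b k \<in> vec.span (b ` {..<k})"
proof (rule ccontr)
  assume "\<not> ?thesis"
  then have "inj_on b {..<Suc CARD('n)} \<and> vec.independent (b ` {..<Suc CARD('n)})"
    by (intro independent_if_notin_span_earlier) auto
  then have "card (b ` {..<Suc CARD('n)}) = Suc CARD('n)"
    and "card (b ` {..<Suc CARD('n)}) \<le> vec.dim (b ` {..<Suc CARD('n)})"
    by (simp_all add: card_image vec.dim_eq_card_independent)
  with dim_subset_UNIV_cart_gen[of "b ` {..<Suc CARD('n)}"] show False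
    by simp
qed

text \<open>Applying \<open>X - \<theta> k\<close> to \<open>w - c *s b k\<close> removes the last
  vector and leaves \<open>(\<mu> - \<theta> k) *s w\<close> in the span of the earlier ones, so
  induction applies.\<close>

lemma eigenvector_in_span_eq_0:
  fixes X :: "complex ^ 'n ^ 'n" and k :: nat
  assumes "\<And>i. i < k \<Longrightarrow> X *v b i = \<theta> i *s b i" "\<And>i. i < k \<Longrightarrow> \<theta> i \<noteq> \<mu>"
    and "X *v w = \<mu> *s w" "w \<in> vec.span (b ` {..<k})"
  shows "w = 0"
  using assms
proof (induction k)
  case 0
  then show ?case by simp
next
  case (Suc k)
  let ?S = "vec.span (b ` {..<k})"
  obtain c where c: "w - c *s b k \<in> ?S"
    using Suc.prems(4) by (auto simp: lessThan_Suc vec.span_breakdown_eq)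
  have inv: "X *v u \<in> ?S" if "u \<in> ?S" for u
    using that
  proof (induction rule: vec.span_induct_alt)
    case base
    then show ?case by (simp add: vec.span_zero)
  next
    case (step a x y)
    then obtain i where "i < k" "x = b i" by auto
    with Suc.prems(1)[of i] have "X *v x \<in> ?S"
      by (simp add: vec.span_base vec.span_scale)
    with step show ?case
      by (simp add: matrix_vector_right_distrib vector_scalar_commute vec.span_add vec.span_scale)
  qed
  have "X *v (w - c *s b k) - \<theta> k *s (w - c *s b k) \<in> ?S"
    using inv[OF c] vec.span_scale[OF c] by (rule vec.span_diff)
  also have "X *v (w - c *s b k) - \<theta> k *s (w - c *s b k) = (\<mu> - \<theta> k) *s w"
    using Suc.prems(1)[of k] Suc.prems(3)
    by (simp add: matrix_vector_mult_diff_distrib vector_scalar_commute vec_eq_iff algebra_simps)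
  finally have "inverse (\<mu> - \<theta> k) *s ((\<mu> - \<theta> k) *s w) \<in> ?S"
    by (rule vec.span_scale)
  moreover have "inverse (\<mu> - \<theta> k) * (\<mu> - \<theta> k) = 1"
    using Suc.prems(2)[of k] by (intro left_inverse) auto
  ultimately have "w \<in> ?S"
    by (simp only: vector_smult_assoc vector_smult_lid)
  with Suc.prems(1-3) show ?case
    by (intro Suc.IH) auto
qed

text \<open>The sum is \<open>p(X) u\<close>. Split off a root, \<open>p = (x - r) q\<close>: either
  \<open>q(X) u\<close> is nonzero and an eigenvector for \<open>r\<close>, or \<open>q\<close>
  annihilates \<open>u\<close> and has smaller degree.\<close>

lemma ex_eigenvector_if_poly_annihilates:
  fixes X :: "complex ^ 'n ^ 'n"
  assumes W: "vec.subspace W" "\<And>w. w \<in> W \<Longrightarrow> X *v w \<in> W"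
    and "u \<in> W" "u \<noteq> 0"
    and "p \<noteq> 0" "degree p = n"
    and "(\<Sum>i\<le>n. coeff p i *s (((*v) X ^^ i) u)) = 0"
  shows "\<exists>v\<in>W. \<exists>r. v \<noteq> 0 \<and> X *v v = r *s v"
  using assms(5-)
proof (induction n arbitrary: p)
  case 0
  then show ?case
    using \<open>u \<noteq> 0\<close> by (auto elim: degree_eq_zeroE)
next
  case (Suc n)
  have powers: "((*v) X ^^ i) u \<in> W" for i
    by (induction i) (use W \<open>u \<in> W\<close> in auto)
  have "\<not> constant (poly p)"
    using Suc.prems(2) by (simp add: constant_degree)
  then obtain r where "poly p r = 0"
    using fundamental_theorem_of_algebra by blast
  then obtain q where q: "p = [:-r, 1:] * q"
    by (auto simp: poly_eq_0_iff_dvd)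
  with Suc.prems(1) have "q \<noteq> 0" by auto
  have deg: "degree q = n"
    using Suc.prems(2) \<open>q \<noteq> 0\<close> degree_mult_eq[of "[:-r, 1:]" q]
    by (simp only: q) simp
  let ?v = "\<Sum>i\<le>n. coeff q i *s (((*v) X ^^ i) u)"
  \<comment> \<open>\<open>pCons 0 q\<close> is \<open>x q\<close>, so its coefficients, shifted by
    one, produce \<open>X *v ?v\<close>.\<close>
  have cf: "coeff p i = coeff (pCons 0 q) i - r * coeff q i" for i
    by (simp add: q)
  have Xv: "X *v ?v = (\<Sum>i\<le>n. coeff q i *s (((*v) X ^^ Suc i) u))"
    by (simp add: vec.sum vector_scalar_commute)
  have "(\<Sum>i\<le>Suc n. coeff p i *s (((*v) X ^^ i) u))
      = (\<Sum>i\<le>Suc n. coeff (pCons 0 q) i *s (((*v) X ^^ i) u))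
        - (\<Sum>i\<le>Suc n. r *s (coeff q i *s (((*v) X ^^ i) u)))"
    unfolding sum_subtractf[symmetric] cf
    by (intro sum.cong refl) (simp only: vec.scale_left_diff_distrib vector_smult_assoc)
  moreover have "(\<Sum>i\<le>Suc n. coeff (pCons 0 q) i *s (((*v) X ^^ i) u)) = X *v ?v"
    unfolding Xv by (subst sum.atMost_Suc_shift) simp
  moreover have "(\<Sum>i\<le>Suc n. r *s (coeff q i *s (((*v) X ^^ i) u))) = r *s ?v"
    using deg by (simp add: vec.scale_sum_right coeff_eq_0)
  ultimately have eig: "X *v ?v = r *s ?v"
    using Suc.prems(3) by simp
  have "?v \<in> W"
    using W powers by (intro vec.subspace_sum vec.subspace_scale) auto
  show ?case
  proof (cases "?v = 0")
    case True
    then show ?thesis by (rule Suc.IH[OF \<open>q \<noteq> 0\<close> deg])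
  next
    case False
    with eig \<open>?v \<in> W\<close> show ?thesis by blast
  qed
qed

lemma ex_eigenvector_in_invariant_subspace:
  fixes X :: "complex ^ 'n ^ 'n"
  assumes "vec.subspace W" "\<And>w. w \<in> W \<Longrightarrow> X *v w \<in> W" "W \<noteq> {0}"
  obtains v r where "v \<in> W" "v \<noteq> 0" "X *v v = r *s v"
proof -
  obtain u where u: "u \<in> W" "u \<noteq> 0"
    using assms(1,3) vec.subspace_0 by blast
  let ?b = "\<lambda>i. ((*v) X ^^ i) u"
  obtain k where "?b k \<in> vec.span (?b ` {..<k})"
    using ex_in_span_earlier[of ?b] by blast
  \<comment> \<open>Elements of the span have the form \<open>p(X) u\<close> with \<open>p\<close>
    of degree below \<open>k\<close>.\<close>
  moreover have "\<exists>p. (\<forall>i\<ge>k. coeff p i = 0) \<and> w = (\<Sum>i<k. coeff p i *s ?b i)"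
    if "w \<in> vec.span (?b ` {..<k})" for w
    using that
  proof (induction rule: vec.span_induct_alt)
    case base
    show ?case by (intro exI[of _ 0]) simp
  next
    case (step c x y)
    then obtain j where j: "j < k" "x = ?b j" by auto
    obtain p where p: "\<forall>i\<ge>k. coeff p i = 0" "y = (\<Sum>i<k. coeff p i *s ?b i)"
      using step by blast
    have "c *s x = (\<Sum>i<k. if i = j then c *s ?b i else 0)"
      using j by simp
    also have "\<dots> = (\<Sum>i<k. coeff (monom c j) i *s ?b i)"
      by (intro sum.cong) auto
    finally have "c *s x + y = (\<Sum>i<k. coeff (monom c j + p) i *s ?b i)"
      unfolding p(2) by (simp add: sum.distrib vector_sadd_rdistrib)
    moreover have "\<forall>i\<ge>k. coeff (monom c j + p) i = 0"
      using j p by simp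
    ultimately show ?case by blast
  qed
  ultimately obtain p where p: "\<forall>i\<ge>k. coeff p i = 0" "?b k = (\<Sum>i<k. coeff p i *s ?b i)"
    by blast
  \<comment> \<open>The dependence becomes a monic polynomial of degree exactly \<open>k\<close>
    that annihilates \<open>u\<close>.\<close>
  let ?q = "monom 1 k - p"
  have ck: "coeff ?q k = 1" using p by simp
  have "degree ?q \<le> k"
    using p(1) by (intro degree_le) simp
  with ck have deg: "degree ?q = k"
    by (metis le_antisym le_degree zero_neq_one)
  have "(\<Sum>i\<le>k. coeff ?q i *s ?b i) = ?b k + (\<Sum>i<k. coeff ?q i *s ?b i)"
    using ck by (simp add: lessThan_Suc_atMost[symmetric] del: coeff_diff)
  also have "(\<Sum>i<k. coeff ?q i *s ?b i) = - (\<Sum>i<k. coeff p i *s ?b i)"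
    unfolding sum_negf[symmetric] by (intro sum.cong) auto
  finally have "(\<Sum>i\<le>k. coeff ?q i *s ?b i) = 0"
    using p(2) by simp
  moreover have "?q \<noteq> 0" using ck by (metis coeff_0 zero_neq_one)
  ultimately show ?thesis
    using ex_eigenvector_if_poly_annihilates[OF assms(1,2) u _ deg] that by blast
qed

section \<open>Irreducible triples with cyclic commutation relations\<close>

locale irreducible_spin_triple =
  fixes X Y Z :: "complex ^ 'n ^ 'n" and W :: "(complex ^ 'n) set"
  assumes subspace: "vec.subspace W" and nonzero: "W \<noteq> {0}"
    and invX: "\<And>w. w \<in> W \<Longrightarrow> X *v w \<in> W"
    and invY: "\<And>w. w \<in> W \<Longrightarrow> Y *v w \<in> W"
    and invZ: "\<And>w. w \<in> W \<Longrightarrow> Z *v w \<in> W"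
    and commXY: "\<And>w. X *v (Y *v w) = Y *v (X *v w) + (2 * \<i>) *s (Z *v w)"
    and commYZ: "\<And>w. Y *v (Z *v w) = Z *v (Y *v w) + (2 * \<i>) *s (X *v w)"
    and commZX: "\<And>w. Z *v (X *v w) = X *v (Z *v w) + (2 * \<i>) *s (Y *v w)"
    and irreducible: "\<And>U. vec.subspace U \<Longrightarrow> U \<subseteq> W \<Longrightarrow> (\<And>u. u \<in> U \<Longrightarrow> X *v u \<in> U) \<Longrightarrow>
      (\<And>u. u \<in> U \<Longrightarrow> Y *v u \<in> U) \<Longrightarrow> (\<And>u. u \<in> U \<Longrightarrow> Z *v u \<in> U) \<Longrightarrow> U = {0} \<or> U = W"
begin

text \<open>The assumptions are invariant under cyclic rotation, so one Leonard condition, proved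
  for \<open>X\<close>, yields all three.\<close>

lemma rotate: "irreducible_spin_triple Y Z X W"
  by unfold_locales (fact subspace nonzero invX invY invZ commXY commYZ commZX | rule irreducible)+

section \<open>Ladder operators and highest weight vectors\<close>

definition raise :: "complex ^ 'n \<Rightarrow> complex ^ 'n" where
  "raise u = Y *v u + \<i> *s (Z *v u)"

definition lower :: "complex ^ 'n \<Rightarrow> complex ^ 'n" where
  "lower u = Y *v u - \<i> *s (Z *v u)"

lemma Y_eq: "Y *v u = (1/2) *s (raise u + lower u)"
  by (simp add: raise_def lower_def vec_eq_iff)

lemma Z_eq: "Z *v u = (\<i>/2) *s (lower u - raise u)"
  by (simp add: raise_def lower_def vec_eq_iff algebra_simps)

lemma raise_scale: "raise (c *s u) = c *s raise u"
  and lower_scale: "lower (c *s u) = c *s lower u"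
  by (simp_all add: raise_def lower_def vec_eq_iff matrix_vector_right_distrib
      vector_scalar_commute algebra_simps)

lemma X_raise: "X *v raise u = raise (X *v u) + 2 *s raise u"
  by (simp add: raise_def vec_eq_iff matrix_vector_right_distrib vector_scalar_commute
      commXY commZX algebra_simps)

lemma X_lower: "X *v lower u = lower (X *v u) - 2 *s lower u"
  by (simp add: lower_def vec_eq_iff matrix_vector_mult_diff_distrib vector_scalar_commute
      commXY commZX algebra_simps)

text \<open>The commutator of \<open>Y + \<i>Z\<close> and \<open>Y - \<i>Z\<close> is
  \<open>-2\<i> [Y, Z]\<close>, which is \<open>4X\<close>.\<close>

lemma raise_lower: "raise (lower u) = lower (raise u) + 4 *s (X *v u)"
  by (simp add: raise_def lower_def vec_eq_iff matrix_vector_mult_diff_distrib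
      matrix_vector_right_distrib vector_scalar_commute commYZ algebra_simps)

lemma raise_in: "u \<in> W \<Longrightarrow> raise u \<in> W"
  unfolding raise_def
  by (intro vec.subspace_add[OF subspace] vec.subspace_scale[OF subspace] invY invZ)

lemma lower_in: "u \<in> W \<Longrightarrow> lower u \<in> W"
  unfolding lower_def
  by (intro vec.subspace_diff[OF subspace] vec.subspace_scale[OF subspace] invY invZ)

lemma ex_highest_weight_vector:
  obtains v \<theta> where "v \<in> W" "v \<noteq> 0" "X *v v = \<theta> *s v" "raise v = 0"
proof -
  obtain u \<theta> where u: "u \<in> W" "u \<noteq> 0" "X *v u = \<theta> *s u"
    using ex_eigenvector_in_invariant_subspace[OF subspace invX nonzero] by metis
  have eig: "X *v (raise ^^ k) u = (\<theta> + 2 * of_nat k) *s (raise ^^ k) u" for k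
  proof (induction k)
    case (Suc k)
    show ?case
      unfolding funpow.simps o_apply X_raise Suc raise_scale
      by (simp add: vec_eq_iff algebra_simps)
  qed (simp add: u)
  \<comment> \<open>The values \<open>\<theta> + 2k\<close> are pairwise distinct, so a term in the
    span of earlier ones must vanish.\<close>
  obtain k where "(raise ^^ k) u \<in> vec.span ((\<lambda>k. (raise ^^ k) u) ` {..<k})"
    using ex_in_span_earlier[of "\<lambda>k. (raise ^^ k) u"] by auto
  from eigenvector_in_span_eq_0[OF eig _ eig this] have "(raise ^^ k) u = 0"
    by auto
  then have least: "(raise ^^ (LEAST k. (raise ^^ k) u = 0)) u = 0"
    by (rule LeastI)
  \<comment> \<open>The least index is positive because \<open>u\<close> is nonzero;
    \<open>m\<close> is the last index before the string vanishes.\<close>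
  then obtain m where m: "(LEAST k. (raise ^^ k) u = 0) = Suc m"
    using u(2) by (cases "LEAST k. (raise ^^ k) u = 0") auto
  then have "(raise ^^ m) u \<noteq> 0"
    using not_less_Least[of m "\<lambda>k. (raise ^^ k) u = 0"] by auto
  moreover have "(raise ^^ m) u \<in> W"
    by (induction m) (use u raise_in in auto)
  moreover have "raise ((raise ^^ m) u) = 0"
    using least m by simp
  ultimately show ?thesis
    using that eig by blast
qed

text \<open>In the lowering string of a highest weight vector, \<open>lower\<close> shifts one step
  forward and \<open>raise\<close> one step back up to a scalar. \<open>Y\<close> and
  \<open>Z\<close> combine the two with nonzero coefficients.\<close>

lemma leonard_condition_X: "leonard_condition W ((*v) X) ((*v) Y) ((*v) Z)"
proof -
  obtain v \<theta> where v: "v \<in> W" "v \<noteq> 0" "X *v v = \<theta> *s v" "raise v = 0"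
    by (rule ex_highest_weight_vector)
  define b where "b k = (lower ^^ k) v" for k
  have b0: "b 0 = v" and bSuc: "b (Suc k) = lower (b k)" for k
    by (simp_all add: b_def)
  have bW: "b k \<in> W" for k
    by (induction k) (simp_all add: b0 bSuc v lower_in)
  have eig: "X *v b k = (\<theta> - 2 * of_nat k) *s b k" for k
  proof (induction k)
    case (Suc k)
    show ?case
      unfolding bSuc X_lower Suc lower_scale by (simp add: vec_eq_iff algebra_simps)
  qed (simp add: b0 v)
  \<comment> \<open>Closed form of the recursion
    \<open>c (k + 1) = c k + 4 (\<theta> - 2 k)\<close>, \<open>c 0 = 0\<close>, which
    \<open>raise_lower\<close> imposes.\<close>
  define c where "c k = 4 * of_nat k * (\<theta> - of_nat k + 1)" for k
  have raise_b: "raise (b (Suc k)) = c (Suc k) *s b k" for k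
  proof (induction k)
    case 0
    have "lower 0 = 0" by (simp add: lower_def)
    then show ?case
      using v(3,4) by (simp add: bSuc raise_lower c_def b0)
  next
    case (Suc k)
    have "raise (b (Suc (Suc k))) = lower (raise (b (Suc k))) + 4 *s (X *v b (Suc k))"
      by (simp only: bSuc[of "Suc k"] raise_lower)
    also have "\<dots> = c (Suc (Suc k)) *s b (Suc k)"
      unfolding Suc eig lower_scale bSuc[symmetric] c_def by (simp add: vec_eq_iff algebra_simps)
    finally show ?case .
  qed
  obtain k where "b k \<in> vec.span (b ` {..<k})"
    using ex_in_span_earlier[of b] by auto
  from eigenvector_in_span_eq_0[OF eig _ eig this] have "b k = 0"
    by auto
  \<comment> \<open>The length of the string, later identified with the dimension of
    \<open>W\<close>.\<close>
  define n where "n = (LEAST k. b k = 0)"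
  have bn: "b n = 0"
    unfolding n_def using \<open>b k = 0\<close> by (rule LeastI)
  have b_nonzero: "b k \<noteq> 0" if "k < n" for k
    using that not_less_Least unfolding n_def by metis
  obtain m where n: "n = Suc m"
    using bn b0 v(2) by (cases n) auto
  \<comment> \<open>Raising the zero vector \<open>b n\<close> forces \<open>c n = 0\<close>. This
    determines the highest weight as \<open>n - 1\<close> and makes every \<open>c k\<close> with
    \<open>0 < k < n\<close> nonzero.\<close>
  have "c n *s b m = 0"
    using raise_b[of m] bn n by (simp add: raise_def)
  then have "c n = 0"
    using b_nonzero[of m] n by (simp add: vec.scale_eq_0_iff)
  moreover have "c n = 4 * of_nat (Suc m) * (\<theta> - of_nat m)"
    by (simp add: c_def n)
  ultimately have \<theta>: "\<theta> = of_nat m"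
    by (simp del: of_nat_Suc)
  have c_nonzero: "c (Suc j) \<noteq> 0" if "Suc j < n" for j
  proof
    assume "c (Suc j) = 0"
    moreover have "c (Suc j) = 4 * of_nat (Suc j) * (of_nat m - of_nat j)"
      by (simp add: c_def \<theta>)
    ultimately show False
      using that n by (simp del: of_nat_Suc)
  qed

  let ?S = "vec.span (b ` {..<n})"
  \<comment> \<open>The boundary case \<open>k = n\<close>, where \<open>b n = 0\<close>, ensures
    that lowering the last basis vector stays in the span.\<close>
  have bS: "b k \<in> ?S" if "k \<le> n" for k
    using that bn by (cases "k = n") (auto simp: vec.span_zero intro!: vec.span_base)
  have raiseS: "raise (b k) \<in> ?S" if "k < n" for k
    using that bS v(4) by (cases k) (auto simp: raise_b b0 vec.span_zero intro!: vec.span_scale)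
  have invS: "M *v u \<in> ?S"
    if "u \<in> ?S" "\<And>k. k < n \<Longrightarrow> M *v b k \<in> ?S" for u and M :: "complex ^ 'n ^ 'n"
    using that(1)
  proof (induction rule: vec.span_induct_alt)
    case base
    then show ?case by (simp add: vec.span_zero)
  next
    case (step a x y)
    then have "M *v x \<in> ?S" using that(2) by auto
    with step show ?case
      by (simp add: matrix_vector_right_distrib vector_scalar_commute vec.span_add vec.span_scale)
  qed
  \<comment> \<open>The span is invariant under all three matrices and contains \<open>v\<close>, so
    irreducibility makes it all of \<open>W\<close>.\<close>
  have "?S = {0} \<or> ?S = W"
  proof (rule irreducible)
    show "vec.subspace ?S" by (rule vec.subspace_span)
    show "?S \<subseteq> W"
      by (rule vec.span_minimal[OF _ subspace]) (auto simp: bW)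
    fix u assume u: "u \<in> ?S"
    show "X *v u \<in> ?S"
      by (rule invS[OF u], unfold eig, intro vec.span_scale bS) simp
    show "Y *v u \<in> ?S"
      by (rule invS[OF u], unfold Y_eq, intro vec.span_scale vec.span_add)
        (simp_all add: raiseS bS bSuc[symmetric])
    show "Z *v u \<in> ?S"
      by (rule invS[OF u], unfold Z_eq, intro vec.span_scale vec.span_diff)
        (simp_all add: raiseS bS bSuc[symmetric])
  qed
  moreover have "v \<in> ?S"
    using bS[of 0] b0 by simp
  ultimately have span: "?S = W"
    using v(2) by auto
  have "inj_on b {..<n} \<and> vec.independent (b ` {..<n})"
  proof (rule independent_if_notin_span_earlier)
    fix k assume "k < n"
    show "b k \<notin> vec.span (b ` {..<k})"
    proof
      assume "b k \<in> vec.span (b ` {..<k})"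
      from eigenvector_in_span_eq_0[OF eig _ eig this] have "b k = 0"
        by auto
      with b_nonzero[OF \<open>k < n\<close>] show False by simp
    qed
  qed
  then have basis: "is_basis_of W n b" and dim: "vec.dim W = n"
    using span by (auto simp: is_basis_of_def span[symmetric] vec.dim_eq_card_independent card_image)

  \<comment> \<open>Column \<open>j\<close> carries \<open>p\<close> below and
    \<open>q * c j\<close> above the diagonal. Cutting off at the ends is correct since
    \<open>lower\<close> kills the last basis vector and \<open>raise\<close> the first.\<close>
  have tri: "represents n b ((*v) M) (\<lambda>i j. if i = Suc j then p else if j = Suc i then q * c j else 0)"
    if M: "\<And>u. M *v u = p *s lower u + q *s raise u" for M p q
    unfolding represents_def
  proof (intro allI impI)
    fix j assume j: "j < n"
    have "(\<Sum>i<n. (if i = Suc j then p else if j = Suc i then q * c j else 0) *s b i)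
        = (\<Sum>i<n. if i = Suc j then p *s b i else 0)
          + (\<Sum>i<n. if j = Suc i then (q * c j) *s b i else 0)"
      unfolding sum.distrib[symmetric] by (intro sum.cong) auto
    also have "(\<Sum>i<n. if i = Suc j then p *s b i else 0) = p *s lower (b j)"
      using j bn by (cases "Suc j = n") (auto simp: bSuc[symmetric])
    also have "(\<Sum>i<n. if j = Suc i then (q * c j) *s b i else 0) = q *s raise (b j)"
      using j v(4) by (cases j) (auto simp: b0 raise_b vector_smult_assoc)
    finally show "M *v b j = (\<Sum>i<n. (if i = Suc j then p else if j = Suc i then q * c j else 0) *s b i)"
      by (simp add: M)
  qed
  have irred: "irreducible_tridiagonal_mat n
      (\<lambda>i j. if i = Suc j then p else if j = Suc i then q * c j else 0)"
    if "p \<noteq> 0" "q \<noteq> 0" for p q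
    using that c_nonzero by (auto simp: irreducible_tridiagonal_mat_def tridiagonal_mat_def)
  have diag: "represents n b ((*v) X) (\<lambda>i j. if i = j then \<theta> - 2 * of_nat j else 0)"
    unfolding represents_def eig
    by (auto simp: if_distrib[of "\<lambda>a. a *s _"] cong: if_cong)
  show ?thesis
    unfolding leonard_condition_def dim
  proof (intro exI conjI)
    show "is_basis_of W n b" by (fact basis)
    show "represents n b ((*v) X) (\<lambda>i j. if i = j then \<theta> - 2 * of_nat j else 0)"
      by (fact diag)
    show "diagonal_mat n (\<lambda>i j. if i = j then \<theta> - 2 * of_nat j else 0)"
      by (simp add: diagonal_mat_def)
    show "represents n b ((*v) Y) (\<lambda>i j. if i = Suc j then 1/2 else if j = Suc i then 1/2 * c j else 0)"
      by (rule tri) (simp add: Y_eq vec_eq_iff algebra_simps)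
    show "represents n b ((*v) Z) (\<lambda>i j. if i = Suc j then \<i>/2 else if j = Suc i then -\<i>/2 * c j else 0)"
      by (rule tri) (simp add: Z_eq vec_eq_iff algebra_simps)
  qed (rule irred; simp)+
qed

lemma dim_pos: "vec.dim W > 0"
  using nonzero vec.subspace_0[OF subspace]
  by (metis empty_iff gr0I subset_singletonD vec.dim_eq_0)

end

text \<open>Rotation lists the companions of \<open>Y\<close> as \<open>Z\<close>, \<open>X\<close>,
  whereas a Leonard triple lists them as \<open>X\<close>, \<open>Z\<close>.\<close>

lemma leonard_condition_commute: "leonard_condition U L L' L'' \<Longrightarrow> leonard_condition U L L'' L'"
  unfolding leonard_condition_def by metis

lemma linear_operator_on_matrix:
  assumes "\<And>u. u \<in> U \<Longrightarrow> M *v u \<in> U"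
  shows "linear_operator_on U ((*v) M)"
  using assms by (simp add: linear_operator_on_def matrix_vector_right_distrib vector_scalar_commute)

lemma (in irreducible_spin_triple) leonard_triple:
  "leonard_triple_on W ((*v) X) ((*v) Y) ((*v) Z)"
proof -
  interpret R: irreducible_spin_triple Y Z X W by (rule rotate)
  interpret R2: irreducible_spin_triple Z X Y W by (rule R.rotate)
  show ?thesis
    unfolding leonard_triple_on_def
    by (intro conjI subspace dim_pos linear_operator_on_matrix invX invY invZ leonard_condition_X
        leonard_condition_commute[OF R.leonard_condition_X] R2.leonard_condition_X)
qed

section \<open>The hypercube\<close>

definition flip :: "'d \<Rightarrow> 'd::finite vertex \<Rightarrow> 'd vertex" where
  "flip i y = (\<chi> j. if j = i then \<not> y $ j else y $ j)"

text \<open>The sign (-1)^(y_i). Summed over all coordinates it gives the diagonal entry of the dual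
  adjacency matrix at \<open>y\<close>.\<close>

definition coord_sign :: "'d \<Rightarrow> 'd::finite vertex \<Rightarrow> complex" where
  "coord_sign i y = (if y $ i then -1 else 1)"

lemma flip_nth: "flip i y $ j = (if j = i then \<not> y $ j else y $ j)"
  by (simp add: flip_def)

lemma flip_flip: "flip i (flip i y) = y"
  by (simp add: vec_eq_iff flip_nth)

lemma flip_commute: "flip i (flip j y) = flip j (flip i y)"
  by (auto simp: vec_eq_iff flip_nth)

lemma inj_flip: "inj (\<lambda>i. flip i y)"
proof (rule injI)
  fix i j
  assume "flip i y = flip j y"
  then have "flip i y $ i = flip j y $ i" by simp
  then show "i = j" by (simp add: flip_nth split: if_splits)
qed

lemma coord_sign_flip:
  "coord_sign k (flip j y) = (if k = j then - coord_sign k y else coord_sign k y)"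
  by (simp add: coord_sign_def flip_nth)

lemma coord_sign_square: "coord_sign i y * (coord_sign i y * a) = a"
  by (simp add: coord_sign_def)

section \<open>Distance from the base vertex as the number of true coordinates\<close>

lemma cube_edges_iff: "(y, z) \<in> cube_edges \<longleftrightarrow> z \<in> range (\<lambda>i. flip i y)"
proof
  assume "(y, z) \<in> cube_edges"
  then obtain i where i: "y $ i \<noteq> z $ i" "\<And>j. y $ j \<noteq> z $ j \<Longrightarrow> j = i"
    by (auto simp: cube_edges_def)
  have "z = flip i y"
    unfolding vec_eq_iff flip_nth using i by metis
  then show "z \<in> range (\<lambda>i. flip i y)" by simp
qed (auto simp: cube_edges_def flip_nth split: if_splits)

text \<open>Each edge flips one coordinate and so enlarges the support by at most one.\<close>

lemma card_support_le_walk_length: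
  "(base_vertex, y) \<in> cube_edges ^^ n \<Longrightarrow> card {i. y $ i} \<le> n"
proof (induction n arbitrary: y)
  case 0
  then show ?case by (auto simp: base_vertex_def)
next
  case (Suc n)
  then obtain z i where z: "(base_vertex, z) \<in> cube_edges ^^ n" "y = flip i z"
    by (auto simp: cube_edges_iff)
  have "card {j. y $ j} \<le> card (insert i {j. z $ j})"
    by (intro card_mono) (auto simp: z flip_nth split: if_splits)
  also have "\<dots> \<le> Suc (card {j. z $ j})"
    by (rule card_insert_le_m1) auto
  finally show ?case
    using Suc.IH[OF z(1)] by simp
qed

text \<open>Flipping a true coordinate of \<open>y\<close> gives a neighbour with smaller support,
  which induction connects to the base vertex.\<close>

lemma walk_of_length_card_support:
  "card {i. y $ i} = n \<Longrightarrow> (base_vertex, y) \<in> cube_edges ^^ n"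
proof (induction n arbitrary: y)
  case 0
  then show ?case by (simp add: base_vertex_def vec_eq_iff)
next
  case (Suc n)
  then have "{i. y $ i} \<noteq> {}" by (metis card.empty nat.distinct(1))
  then obtain i where i: "y $ i" by blast
  have "{j. flip i y $ j} = {j. y $ j} - {i}"
    using i by (auto simp: flip_nth split: if_splits)
  then have "card {j. flip i y $ j} = n"
    using i Suc.prems by simp
  then have "(base_vertex, flip i y) \<in> cube_edges ^^ n"
    by (rule Suc.IH)
  moreover have "(flip i y, y) \<in> cube_edges"
    unfolding cube_edges_iff by (metis flip_flip rangeI)
  ultimately show ?case by auto
qed

lemma cube_dist_base_vertex: "cube_dist base_vertex y = card {i. y $ i}"
  unfolding cube_dist_def
  using walk_of_length_card_support card_support_le_walk_length
  by (intro Least_equality) blast+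

section \<open>The three matrices as sums over coordinates\<close>

lemma adjacency_matrix_vector: "(adjacency_matrix *v w) $ y = (\<Sum>i\<in>UNIV. w $ flip i y)"
proof -
  have "(adjacency_matrix *v w) $ y = (\<Sum>z\<in>UNIV. if z \<in> range (\<lambda>i. flip i y) then w $ z else 0)"
    by (simp add: adjacency_matrix_def matrix_vector_mult_def cube_edges_iff if_distrib[of "\<lambda>a. a * _"]
        cong: if_cong)
  also have "\<dots> = (\<Sum>z\<in>range (\<lambda>i. flip i y). w $ z)"
    by (simp add: sum.If_cases)
  also have "\<dots> = (\<Sum>i\<in>UNIV. w $ flip i y)"
    using inj_flip by (subst sum.reindex) auto
  finally show ?thesis .
qed

lemma dual_adjacency_matrix_vector:
  "(dual_adjacency_matrix *v w) $ y = (\<Sum>i\<in>UNIV. coord_sign i y) * w $ y"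
proof -
  have "(\<Sum>i\<in>UNIV. coord_sign i y) = (\<Sum>i\<in>UNIV. 1 - 2 * (if y $ i then 1 else 0))"
    by (intro sum.cong) (auto simp: coord_sign_def)
  also have "\<dots> = of_nat CARD('a) - 2 * of_nat (card {i. y $ i})"
    by (simp add: sum_subtractf sum_distrib_left[symmetric] sum.If_cases)
  finally show ?thesis
    by (simp add: dual_adjacency_matrix_def matrix_vector_mult_def cube_dist_base_vertex
        if_distrib[of "\<lambda>a. a * _"] cong: if_cong)
qed

lemma smult_matrix_vector: "smult_matrix c M *v w = c *s (M *v w)"
  by (simp add: smult_matrix_def matrix_vector_mult_def vec_eq_iff sum_distrib_left mult.assoc)

lemma sum_coord_sign_flip:
  "(\<Sum>i\<in>UNIV. coord_sign i (flip j y)) = (\<Sum>i\<in>UNIV. coord_sign i y) - 2 * coord_sign j y"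
proof -
  have "(\<Sum>i\<in>UNIV. coord_sign i (flip j y))
      = (\<Sum>i\<in>UNIV. coord_sign i y - (if i = j then 2 * coord_sign i y else 0))"
    by (intro sum.cong) (auto simp: coord_sign_flip)
  then show ?thesis
    by (simp add: sum_subtractf)
qed

lemma imaginary_adjacency_matrix_eq:
  "imaginary_adjacency_matrix *v w = (- \<i> / 2) *s
    (adjacency_matrix *v (dual_adjacency_matrix *v w) - dual_adjacency_matrix *v (adjacency_matrix *v w))"
  by (simp only: imaginary_adjacency_matrix_def smult_matrix_vector matrix_vector_mult_diff_rdistrib
      matrix_vector_mul_assoc)

text \<open>Moving from \<open>y\<close> to \<open>flip i y\<close> lowers the sign sum by
  \<open>2 * coord_sign i y\<close>. The commutator thus contributes the factor -2, and
  \<open>-2 * (-\<i>/2) = \<i>\<close>.\<close>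

lemma imaginary_adjacency_matrix_vector:
  "(imaginary_adjacency_matrix *v w) $ y = \<i> * (\<Sum>i\<in>UNIV. coord_sign i y * w $ flip i y)"
proof -
  have "(\<Sum>i\<in>UNIV. (\<Sum>k\<in>UNIV. coord_sign k (flip i y)) * w $ flip i y)
      = (\<Sum>k\<in>UNIV. coord_sign k y) * (\<Sum>i\<in>UNIV. w $ flip i y)
        - 2 * (\<Sum>i\<in>UNIV. coord_sign i y * w $ flip i y)"
    by (simp add: sum_coord_sign_flip left_diff_distrib sum_subtractf sum_distrib_left mult.assoc)
  then show ?thesis
    by (simp add: imaginary_adjacency_matrix_eq adjacency_matrix_vector dual_adjacency_matrix_vector
        right_diff_distrib diff_divide_distrib)
qed

section \<open>The cyclic commutation relations\<close>

lemma adjacency_dual_commutator: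
  "adjacency_matrix *v (dual_adjacency_matrix *v w)
    = dual_adjacency_matrix *v (adjacency_matrix *v w) + (2 * \<i>) *s (imaginary_adjacency_matrix *v w)"
  by (simp add: imaginary_adjacency_matrix_eq vector_smult_assoc)

text \<open>The sign sum changes by \<open>2 * coord_sign i y\<close> along a flip. This meets a
  second factor \<open>coord_sign i y\<close>, and the square 1 leaves the plain sum over
  neighbours.\<close>

lemma dual_imaginary_commutator:
  "dual_adjacency_matrix *v (imaginary_adjacency_matrix *v w)
    = imaginary_adjacency_matrix *v (dual_adjacency_matrix *v w) + (2 * \<i>) *s (adjacency_matrix *v w)"
  (is "?l = ?r")
proof -
  have "?l $ y = ?r $ y" for y
  proof -
    have "(\<Sum>i\<in>UNIV. coord_sign i y * ((\<Sum>k\<in>UNIV. coord_sign k (flip i y)) * w $ flip i y))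
        = (\<Sum>i\<in>UNIV. (\<Sum>k\<in>UNIV. coord_sign k y) * (coord_sign i y * w $ flip i y) - 2 * w $ flip i y)"
      by (intro sum.cong refl)
        (simp add: sum_coord_sign_flip right_diff_distrib left_diff_distrib coord_sign_square ac_simps)
    also have "\<dots> = (\<Sum>k\<in>UNIV. coord_sign k y) * (\<Sum>i\<in>UNIV. coord_sign i y * w $ flip i y)
        - 2 * (\<Sum>i\<in>UNIV. w $ flip i y)"
      by (simp only: sum_subtractf sum_distrib_left)
    finally show ?thesis
      unfolding vector_add_component vector_smult_component imaginary_adjacency_matrix_vector
        adjacency_matrix_vector dual_adjacency_matrix_vector
      by (simp only:) (simp add: algebra_simps)
  qed
  then show ?thesis by (simp add: vec_eq_iff)
qed

text \<open>Both products are double sums over pairs of flips, which commute. They differ only in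
  the terms with equal flips: there the flips cancel but the sign is reversed, leaving a multiple of
  the sign sum times \<open>w $ y\<close>.\<close>

lemma imaginary_adjacency_commutator:
  "imaginary_adjacency_matrix *v (adjacency_matrix *v w)
    = adjacency_matrix *v (imaginary_adjacency_matrix *v w) + (2 * \<i>) *s (dual_adjacency_matrix *v w)"
  (is "?l = ?r")
proof -
  have "?l $ y = ?r $ y" for y
  proof -
    let ?w = "\<lambda>j k. w $ flip k (flip j y)"
    have "(\<Sum>k\<in>UNIV. coord_sign k (flip j y) * ?w j k)
        = (\<Sum>k\<in>UNIV. coord_sign k y * ?w j k) - 2 * (coord_sign j y * w $ y)" for j
    proof -
      have "(\<Sum>k\<in>UNIV. coord_sign k (flip j y) * ?w j k)
          = (\<Sum>k\<in>UNIV. coord_sign k y * ?w j k - (if k = j then 2 * (coord_sign j y * w $ y) else 0))"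
        by (intro sum.cong) (auto simp: coord_sign_flip flip_flip)
      then show ?thesis by (simp add: sum_subtractf)
    qed
    then have "(\<Sum>j\<in>UNIV. \<Sum>k\<in>UNIV. coord_sign k (flip j y) * ?w j k)
        = (\<Sum>j\<in>UNIV. \<Sum>k\<in>UNIV. coord_sign k y * ?w j k) - 2 * (\<Sum>j\<in>UNIV. coord_sign j y) * w $ y"
      by (simp add: sum_subtractf sum_distrib_left sum_distrib_right mult.assoc)
    also have "(\<Sum>j\<in>UNIV. \<Sum>k\<in>UNIV. coord_sign k y * ?w j k)
        = (\<Sum>k\<in>UNIV. coord_sign k y * (\<Sum>j\<in>UNIV. w $ flip j (flip k y)))"
      by (subst sum.swap) (simp add: sum_distrib_left flip_commute)
    finally show ?thesis
      unfolding vector_add_component vector_smult_component imaginary_adjacency_matrix_vector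
        adjacency_matrix_vector dual_adjacency_matrix_vector sum_distrib_left[symmetric]
      by (simp only:) (simp add: algebra_simps)
  qed
  then show ?thesis by (simp add: vec_eq_iff)
qed

section \<open>Modules of the Terwilliger algebra\<close>

text \<open>The matrices that map a subspace \<open>U\<close> into itself form a subalgebra, so it
  contains the generated one as soon as it contains \<open>G\<close>.\<close>

lemma is_module_generated_subalgebra_iff:
  "is_module (generated_subalgebra G) U \<longleftrightarrow> vec.subspace U \<and> (\<forall>B\<in>G. \<forall>u\<in>U. B *v u \<in> U)"
proof (cases "vec.subspace U")
  case True
  have "matrix_subalgebra {B. \<forall>u\<in>U. B *v u \<in> U}"
    using True by (auto simp: matrix_subalgebra_def matrix_vector_mult_add_rdistrib smult_matrix_vector
        matrix_vector_mul_assoc[symmetric] vec.subspace_add vec.subspace_scale)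
  then have "G \<subseteq> {B. \<forall>u\<in>U. B *v u \<in> U} \<Longrightarrow> generated_subalgebra G \<subseteq> {B. \<forall>u\<in>U. B *v u \<in> U}"
    unfolding generated_subalgebra_def by (intro Inter_lower) simp
  moreover have "G \<subseteq> generated_subalgebra G"
    by (auto simp: generated_subalgebra_def)
  ultimately show ?thesis
    using True by (auto simp: is_module_def)
qed (simp add: is_module_def)

theorem corollary10p5:
  fixes W :: "(complex ^ ('d::finite vertex)) set"
  assumes "irreducible_module terwilliger_algebra W"
  shows "leonard_triple_on W ((*v) adjacency_matrix) ((*v) dual_adjacency_matrix)
           ((*v) imaginary_adjacency_matrix)"
proof -
  have module_iff: "is_module terwilliger_algebra U \<longleftrightarrow> vec.subspace U \<and>
      (\<forall>u\<in>U. adjacency_matrix *v u \<in> U) \<and> (\<forall>u\<in>U. dual_adjacency_matrix *v u \<in> U)"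
    for U :: "(complex ^ ('d vertex)) set"
    by (simp add: terwilliger_algebra_def is_module_generated_subalgebra_iff)
  have W: "vec.subspace W" "\<And>u. u \<in> W \<Longrightarrow> adjacency_matrix *v u \<in> W"
    "\<And>u. u \<in> W \<Longrightarrow> dual_adjacency_matrix *v u \<in> W"
    using assms by (auto simp: irreducible_module_def module_iff)
  interpret irreducible_spin_triple adjacency_matrix dual_adjacency_matrix
    imaginary_adjacency_matrix W
  proof
    \<comment> \<open>A scalar multiple of the commutator of two matrices preserving
      \<open>W\<close> preserves \<open>W\<close>.\<close>
    show "imaginary_adjacency_matrix *v u \<in> W" if "u \<in> W" for u
      unfolding imaginary_adjacency_matrix_eq using that W
      by (intro vec.subspace_scale vec.subspace_diff) auto
    show "W \<noteq> {0}"
      using assms by (simp add: irreducible_module_def)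
    \<comment> \<open>By \<open>module_iff\<close>, invariance under the two generators makes
      \<open>U\<close> a submodule of \<open>W\<close>.\<close>
    show "U = {0} \<or> U = W"
      if "vec.subspace U" "U \<subseteq> W" "\<And>u. u \<in> U \<Longrightarrow> adjacency_matrix *v u \<in> U"
        "\<And>u. u \<in> U \<Longrightarrow> dual_adjacency_matrix *v u \<in> U" for U
      using assms that unfolding irreducible_module_def module_iff by blast
  qed (use W in \<open>auto simp: adjacency_dual_commutator dual_imaginary_commutator
      imaginary_adjacency_commutator\<close>)
  show ?thesis by (rule leonard_triple)
qed

end
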